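(* Let $G^{1\ldots k}$ be a system of $k$ networks with user set $U$, let $\alpha^i(u)>0$ ($1\le i\le k$, $u\in U$) be arbitrary positive parameters, and let $G$ be the coupled network on vertex set $U$ produced by the lossy coupling scheme with these parameters. Let $0<\beta\le1$ and let $d\ge 1$ be an integer. If a set of users $S\subseteq U$ activates $\beta$ fraction of the users in $G$ after $d$ propagation hops, then $S$ activates at least $\beta$ fraction of the users in $G^{1\ldots k}$ after $d$ propagation hops; that is, $|A^d(G,S)|\ge\beta|U|$ implies $|A^d(G^{1\ldots k},S)|\ge\beta|U|$.
   Context: Multiplex system. $G^{1\ldots k}$ consists of $k$ finite weighted directed graphs $G^i=(V^i,E^i,\theta^i,W^i)$, $1\le i\le k$, without self-loops, with edge weights $w^i(u,v)\ge 0$ for $(u,v)\in E^i$ and a threshold $\theta^i(u)$ for each $u\in V^i$. The same user may belong to several $V^i$. $U=\bigcup_{i=1}^k V^i$ is the set of all users. $N_u^{i-}$ is the set of in-neighbors of $u$ in $G^i$. Propagation in the system (Linear Threshold model). Given a seed set $S\subseteq U$, the users in $S$ are active at time $0$ and all others inactive. Active users remain active. At time $t\ge1$ an inactive user $u$ becomes active iff there is some $i$ with $u\in V^i$ and $\sum_{v\in N_u^{i-}\cap A} w^i(v,u)\ge\theta^i(u)$, where $A$ is the set of users active after time $t-1$. $A^d(G^{1\ldots k},S)$ is the set of users active after $d$ time steps (propagation hops). Propagation in a single network is the case $k=1$ of this, and $A^d(G,S)$ is the corresponding set of active vertices. Lossy coupling scheme with positive parameters $\{\alpha^i(u)\}$.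 The coupled network $G$ is a single weighted directed graph with thresholds, whose vertex set is $U$. The threshold of $u$ is $\theta(u)=\sum_{i}\alpha^i(u)\theta^i(u)$, and for users $v,u$ the weight is $w(v,u)=\sum_{i}\alpha^i(u)w^i(v,u)$, where $w^i(v,u)=0$ if there is no edge from $v$ to $u$ in $G^i$; the sums run over those $i\in\{1,\ldots,k\}$ with $u\in V^i$. The edge set is $E=\{(v,u): w(v,u)>0\}$. *)

theory Defs
  imports Complex_Main "Graph_Theory.Pair_Digraph"
begin

record 'a network =
  graph :: "'a pair_pre_digraph"
  threshold :: "'a \<Rightarrow> real"
  weight :: "'a \<Rightarrow> 'a \<Rightarrow> real"

text \<open>
  The values of \<open>threshold\<close> outside the vertex set and of \<open>weight\<close> outside the arc set are
  irrelevant: nothing below reads them. An arc \<open>(v, u)\<close> points from \<open>v\<close> to \<open>u\<close>, and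
  \<open>weight N v u\<close> is the influence of \<open>v\<close> on \<open>u\<close>.
\<close>

definition network :: "'a network \<Rightarrow> bool" where
  "network N \<longleftrightarrow> pair_digraph (graph N) \<and>
     (\<forall>(u, v) \<in> parcs (graph N). weight N u v \<ge> 0)"

definition in_neighbors :: "'a network \<Rightarrow> 'a \<Rightarrow> 'a set" where
  "in_neighbors N u = {v. (v, u) \<in> parcs (graph N)}"

text \<open>
  A system of \<open>k\<close> networks is a family indexed by \<open>{1..k}\<close>. All networks share one type of
  users, so a user may belong to several of them.
\<close>

definition users :: "nat \<Rightarrow> (nat \<Rightarrow> 'a network) \<Rightarrow> 'a set" where
  "users k G = (\<Union>i\<in>{1..k}. pverts (graph (G i)))"

primrec active :: "nat \<Rightarrow> (nat \<Rightarrow> 'a network) \<Rightarrow> 'a set \<Rightarrow> nat \<Rightarrow> 'a set" where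
  "active k G S 0 = S"
| "active k G S (Suc t) = active k G S t \<union>
     {u. \<exists>i\<in>{1..k}. u \<in> pverts (graph (G i)) \<and>
           (\<Sum>v \<in> in_neighbors (G i) u \<inter> active k G S t. weight (G i) v u)
             \<ge> threshold (G i) u}"

definition active1 :: "'a network \<Rightarrow> 'a set \<Rightarrow> nat \<Rightarrow> 'a set" where
  "active1 N S d = active 1 (\<lambda>_. N) S d"

text \<open>The weight extended by zero to pairs that are not arcs.\<close>

definition weight0 :: "'a network \<Rightarrow> 'a \<Rightarrow> 'a \<Rightarrow> real" where
  "weight0 N v u = (if (v, u) \<in> parcs (graph N) then weight N v u else 0)"

definition coupled_threshold ::
  "nat \<Rightarrow> (nat \<Rightarrow> 'a network) \<Rightarrow> (nat \<Rightarrow> 'a \<Rightarrow> real) \<Rightarrow> 'a \<Rightarrow> real" where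
  "coupled_threshold k G \<alpha> u =
     (\<Sum>i | i \<in> {1..k} \<and> u \<in> pverts (graph (G i)). \<alpha> i u * threshold (G i) u)"

definition coupled_weight ::
  "nat \<Rightarrow> (nat \<Rightarrow> 'a network) \<Rightarrow> (nat \<Rightarrow> 'a \<Rightarrow> real) \<Rightarrow> 'a \<Rightarrow> 'a \<Rightarrow> real" where
  "coupled_weight k G \<alpha> v u =
     (\<Sum>i | i \<in> {1..k} \<and> u \<in> pverts (graph (G i)). \<alpha> i u * weight0 (G i) v u)"

definition lossy_coupling ::
  "nat \<Rightarrow> (nat \<Rightarrow> 'a network) \<Rightarrow> (nat \<Rightarrow> 'a \<Rightarrow> real) \<Rightarrow> 'a network" where
  "lossy_coupling k G \<alpha> =
     \<lparr> graph = \<lparr> pverts = users k G,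
                 parcs = {(v, u) \<in> users k G \<times> users k G. coupled_weight k G \<alpha> v u > 0} \<rparr>,
       threshold = coupled_threshold k G \<alpha>,
       weight = coupled_weight k G \<alpha> \<rparr>"

lemma network_lossy_coupling:
  assumes "\<And>i. i \<in> {1..k} \<Longrightarrow> network (G i)"
  shows "network (lossy_coupling k G \<alpha>)"
proof -
  have fin: "finite (users k G)"
    using assms unfolding users_def network_def pair_digraph_def
    by (auto intro: pair_fin_digraph.pair_finite_verts)
  have loop: "coupled_weight k G \<alpha> u u = 0" for u
  proof -
    have "(u, u) \<notin> parcs (graph (G i))" if "i \<in> {1..k}" for i
      using assms[OF that] unfolding network_def pair_digraph_def
      by (auto dest: pair_loopfree_digraph.pair_no_loops)
    then show ?thesis
      unfolding coupled_weight_def weight0_def by (auto intro: sum.neutral)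
  qed
  let ?E = "{(v, u) \<in> users k G \<times> users k G. coupled_weight k G \<alpha> v u > 0}"
  have "finite ?E"
    by (rule finite_subset[of _ "users k G \<times> users k G"]) (use fin in auto)
  then show ?thesis
    unfolding network_def lossy_coupling_def
    using fin loop by (auto, unfold_locales) force+
qed

end

theory Submission
  imports Defs
begin

text \<open>
  If no single network activates \<open>u\<close> from the active set \<open>A\<close>, then multiplying each failed
  threshold inequality by \<open>\<alpha> i u > 0\<close> and summing over the networks containing \<open>u\<close> shows that
  the coupled network does not activate \<open>u\<close> from \<open>A\<close> either. So, hop by hop, the active set of
  the coupled network stays inside that of the system.
\<close>

text \<open>Moving the arc condition into the summand makes the range of summation the same for
  every network, so that sums over users and over networks can later be swapped.\<close>

lemma sum_in_neighbors_Int: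
  assumes "finite A"
  shows "(\<Sum>v \<in> in_neighbors N u \<inter> A. weight N v u) = (\<Sum>v\<in>A. weight0 N v u)"
proof -
  have "(\<Sum>v \<in> A \<inter> in_neighbors N u. weight N v u)
      = (\<Sum>v\<in>A. if v \<in> in_neighbors N u then weight N v u else 0)"
    using assms by (rule sum.inter_restrict)
  also have "\<dots> = (\<Sum>v\<in>A. weight0 N v u)"
    by (simp add: in_neighbors_def weight0_def)
  finally show ?thesis by (simp add: Int_commute)
qed

lemma weight0_nonneg: "network N \<Longrightarrow> weight0 N v u \<ge> 0"
  by (auto simp: weight0_def network_def)

lemma finite_users:
  assumes "\<And>i. i \<in> {1..k} \<Longrightarrow> network (G i)"
  shows "finite (users k G)"
  using assms unfolding users_def network_def pair_digraph_def
  by (auto intro: pair_fin_digraph.pair_finite_verts)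

lemma active_subset_users: "S \<subseteq> users k G \<Longrightarrow> active k G S t \<subseteq> users k G"
  by (induction t) (auto simp: users_def)

lemma pverts_lossy_coupling [simp]: "pverts (graph (lossy_coupling k G \<alpha>)) = users k G"
  and threshold_lossy_coupling [simp]:
    "threshold (lossy_coupling k G \<alpha>) = coupled_threshold k G \<alpha>"
  by (simp_all add: lossy_coupling_def)

lemma coupled_weight_nonneg:
  assumes "\<And>i. i \<in> {1..k} \<Longrightarrow> network (G i)"
    and "\<And>i. i \<in> {1..k} \<Longrightarrow> \<alpha> i u \<ge> 0"
  shows "coupled_weight k G \<alpha> v u \<ge> 0"
  unfolding coupled_weight_def
  using assms by (auto intro!: sum_nonneg mult_nonneg_nonneg weight0_nonneg)

text \<open>Pairs that are not arcs get 0, which is where nonnegativity enters. An upper bound is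
  enough later and avoids a case split on whether \<open>v\<close> and \<open>u\<close> are
  users.\<close>

lemma weight0_lossy_coupling_le:
  assumes "coupled_weight k G \<alpha> v u \<ge> 0"
  shows "weight0 (lossy_coupling k G \<alpha>) v u \<le> coupled_weight k G \<alpha> v u"
  using assms by (simp add: weight0_def lossy_coupling_def)

text \<open>Using two sets builds monotonicity into the one-hop statement: in the induction over
  hops, \<open>B\<close> is the active set of the coupled network and \<open>A\<close> that of the
  system.\<close>

lemma lossy_coupling_activation:
  assumes net: "\<And>i. i \<in> {1..k} \<Longrightarrow> network (G i)"
    and \<alpha>: "\<And>i. i \<in> {1..k} \<Longrightarrow> \<alpha> i u > 0"
    and u: "u \<in> users k G"
    and A: "finite A" "B \<subseteq> A"
    and B: "(\<Sum>v \<in> in_neighbors (lossy_coupling k G \<alpha>) u \<inter> B. weight (lossy_coupling k G \<alpha>) v u)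
      \<ge> coupled_threshold k G \<alpha> u"
  shows "\<exists>i\<in>{1..k}. u \<in> pverts (graph (G i)) \<and>
    (\<Sum>v \<in> in_neighbors (G i) u \<inter> A. weight (G i) v u) \<ge> threshold (G i) u"
proof (rule ccontr)
  let ?I = "{i. i \<in> {1..k} \<and> u \<in> pverts (graph (G i))}"
  assume "\<not> ?thesis"
  then have less: "(\<Sum>v\<in>A. weight0 (G i) v u) < threshold (G i) u" if "i \<in> ?I" for i
    using that sum_in_neighbors_Int[OF A(1), of "G i" u] by force
  have cw: "coupled_weight k G \<alpha> v u \<ge> 0" for v
    using net \<alpha> by (intro coupled_weight_nonneg) (auto intro: less_imp_le)
  have "coupled_threshold k G \<alpha> u \<le> (\<Sum>v\<in>B. weight0 (lossy_coupling k G \<alpha>) v u)"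
    using B sum_in_neighbors_Int[OF finite_subset[OF A(2,1)]] by simp
  also have "\<dots> \<le> (\<Sum>v\<in>B. coupled_weight k G \<alpha> v u)"
    by (intro sum_mono weight0_lossy_coupling_le cw)
  \<comment> \<open>Extra active users can only add influence, since coupled weights are
    nonnegative.\<close>
  also have "\<dots> \<le> (\<Sum>v\<in>A. coupled_weight k G \<alpha> v u)"
    using A cw by (intro sum_mono2) auto
  \<comment> \<open>The swap turns the total coupled influence on \<open>u\<close> into an
    \<alpha>-weighted combination of the influences within each network, to which
    \<open>less\<close> applies termwise.\<close>
  also have "\<dots> = (\<Sum>i\<in>?I. \<alpha> i u * (\<Sum>v\<in>A. weight0 (G i) v u))"
    unfolding coupled_weight_def sum_distrib_left by (rule sum.swap)
  also have "\<dots> < coupled_threshold k G \<alpha> u"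
    unfolding coupled_threshold_def
  proof (rule sum_strict_mono)
    \<comment> \<open>A strict inequality of sums needs at least one term; a user lies in some
      network.\<close>
    show "?I \<noteq> {}" using u by (auto simp: users_def)
    show "\<alpha> i u * (\<Sum>v\<in>A. weight0 (G i) v u) < \<alpha> i u * threshold (G i) u" if "i \<in> ?I" for i
      using less[OF that] \<alpha>[of i] that by simp
  qed simp
  finally show False by simp
qed

lemma active1_lossy_coupling_subset:
  assumes net: "\<And>i. i \<in> {1..k} \<Longrightarrow> network (G i)"
    and \<alpha>: "\<And>i u. i \<in> {1..k} \<Longrightarrow> u \<in> users k G \<Longrightarrow> \<alpha> i u > 0"
    and S: "S \<subseteq> users k G"
  shows "active1 (lossy_coupling k G \<alpha>) S t \<subseteq> active k G S t"
proof (induction t)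
  case 0
  then show ?case by (simp add: active1_def)
next
  case (Suc t)
  have fin: "finite (active k G S t)"
    using active_subset_users[OF S] finite_users[OF net] by (rule finite_subset)
  show ?case
  proof
    fix u
    assume "u \<in> active1 (lossy_coupling k G \<alpha>) S (Suc t)"
    \<comment> \<open>The index range \<open>{1..1}\<close> of a single network leaves one threshold
      condition: \<open>u\<close> was active before or meets it now.\<close>
    then consider "u \<in> active1 (lossy_coupling k G \<alpha>) S t"
      | "u \<in> users k G"
        "(\<Sum>v \<in> in_neighbors (lossy_coupling k G \<alpha>) u \<inter> active1 (lossy_coupling k G \<alpha>) S t.
            weight (lossy_coupling k G \<alpha>) v u) \<ge> coupled_threshold k G \<alpha> u"
      by (auto simp: active1_def)
    then show "u \<in> active k G S (Suc t)"
    proof cases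
      case 1
      then show ?thesis using Suc.IH by auto
    next
      case 2
      then show ?thesis
        using lossy_coupling_activation[OF net \<alpha>[OF _ 2(1)] 2(1) fin Suc.IH 2(2)] by simp
    qed
  qed
qed

theorem theorem5:
  fixes k d :: nat
    and G :: "nat \<Rightarrow> 'a network"
    and \<alpha> :: "nat \<Rightarrow> 'a \<Rightarrow> real"
    and \<beta> :: real
    and S :: "'a set"
  assumes "\<And>i. i \<in> {1..k} \<Longrightarrow> network (G i)"
    and "\<And>i u. i \<in> {1..k} \<Longrightarrow> u \<in> users k G \<Longrightarrow> \<alpha> i u > 0"
    and "0 < \<beta>" and "\<beta> \<le> 1"
    and "d \<ge> 1"
    and "S \<subseteq> users k G"
    and "real (card (active1 (lossy_coupling k G \<alpha>) S d)) \<ge> \<beta> * real (card (users k G))"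
  shows "real (card (active k G S d)) \<ge> \<beta> * real (card (users k G))"
proof -
  have "card (active1 (lossy_coupling k G \<alpha>) S d) \<le> card (active k G S d)"
  proof (rule card_mono)
    \<comment> \<open>\<open>card\<close> is 0 on infinite sets, so the larger set must be finite
      for inclusion to bound cardinalities.\<close>
    show "finite (active k G S d)"
      using active_subset_users[OF assms(6)] finite_users[OF assms(1)] by (rule finite_subset)
    show "active1 (lossy_coupling k G \<alpha>) S d \<subseteq> active k G S d"
      using assms(1,2,6) by (rule active1_lossy_coupling_subset)
  qed
  with assms(7) show ?thesis by linarith
qed

end
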